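(* Let $m,n>0$ and $c_1,c_2,c_3\in\mathbb{R}$, and assume $mc_1-mn-n^2\neq0$ and $nc_1+mn+m^2\neq0$. Then the integral curves $\gamma(s)=(x(s),y(s),t(s))$, $\gamma'(s)=\xi_{\gamma(s)}$, of the Ricci soliton vector field $$\xi=\left[(mc_1-mn-n^2)x+c_2\right]\frac{\partial}{\partial x}-\left[(nc_1+mn+m^2)y+c_3\right]\frac{\partial}{\partial y}+c_1\frac{\partial}{\partial t}$$ on $\mathrm{Sol}^3_{m,n}$ are given by $$\begin{cases}x(s)=a_1e^{(mc_1-mn-n^2)s}-\dfrac{c_2}{mc_1-mn-n^2},\\[2mm] y(s)=a_2e^{-(nc_1+mn+m^2)s}-\dfrac{c_3}{nc_1+mn+m^2},\\[2mm] t(s)=c_1s+t_0,\end{cases}$$ where $a_1,a_2,t_0\in\mathbb{R}$. Moreover, all these integral curves are defined for every $s\in\mathbb{R}$; consequently, the vector field $\xi$ is complete.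
   Context: For real $m,n>0$, $\mathrm{Sol}^3_{m,n}$ is the semidirect product $\mathbb{R}^2\rtimes_U\mathbb{R}$ with $U(t)=\mathrm{diag}(e^{mt},e^{-nt})$; its underlying manifold is $\mathbb{R}^3$ with global coordinates $(x,y,t)$. It carries the left-invariant Riemannian metric $g=e^{-2mt}dx^2+e^{2nt}dy^2+dt^2$. The vector fields $\xi$ in the claim are the vector fields satisfying the Ricci soliton equation $\operatorname{Ric}+\frac12\mathcal{L}_\xi g=\lambda g$ for some constant $\lambda$. *)

theory Defs
  imports "HOL-Analysis.Analysis"
begin

section \<open>Calculus in global coordinates\<close>

text \<open>The manifolds considered have one global chart, so vector fields are maps
  from \<open>\<real>\<^sup>n\<close> to \<open>\<real>\<^sup>n\<close> and metrics are matrix-valued functions on \<open>\<real>\<^sup>n\<close>.\<close>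

definition pderiv_at :: "'n::finite \<Rightarrow> (real ^ 'n \<Rightarrow> 'b::real_normed_vector) \<Rightarrow> real ^ 'n \<Rightarrow> 'b"
  where "pderiv_at i f p = frechet_derivative f (at p) (axis i 1)"

text \<open>Smooth: all iterated partial derivatives exist and are differentiable everywhere.\<close>

definition smooth_field :: "(real ^ 'n::finite \<Rightarrow> 'b::real_normed_vector) \<Rightarrow> bool"
  where "smooth_field f \<longleftrightarrow> (\<forall>is. foldr pderiv_at is f differentiable_on UNIV)"

text \<open>\<open>christoffel g k i j\<close> is the Levi-Civita symbol \<open>\<Gamma>\<^sup>k\<^sub>i\<^sub>j\<close> of the metric \<open>g\<close>.\<close>

definition christoffel ::
    "(real ^ 'n \<Rightarrow> real ^ 'n ^ 'n) \<Rightarrow> 'n::finite \<Rightarrow> 'n \<Rightarrow> 'n \<Rightarrow> real ^ 'n \<Rightarrow> real"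
  where "christoffel g k i j p =
    (1/2) * (\<Sum>l\<in>UNIV. matrix_inv (g p) $ k $ l *
       (pderiv_at i (\<lambda>q. g q $ j $ l) p + pderiv_at j (\<lambda>q. g q $ i $ l) p
        - pderiv_at l (\<lambda>q. g q $ i $ j) p))"

text \<open>Sign convention: the round sphere has positive Ricci curvature.\<close>

definition ricci :: "(real ^ 'n \<Rightarrow> real ^ 'n ^ 'n) \<Rightarrow> real ^ 'n \<Rightarrow> real ^ 'n ^ 'n::finite"
  where "ricci g p = (\<chi> j k.
    (\<Sum>i\<in>UNIV. pderiv_at i (christoffel g i j k) p - pderiv_at k (christoffel g i i j) p
       + (\<Sum>l\<in>UNIV. christoffel g i i l p * christoffel g l j k p
                  - christoffel g i k l p * christoffel g l i j p)))"

definition lie_deriv_metric ::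
    "(real ^ 'n \<Rightarrow> real ^ 'n) \<Rightarrow> (real ^ 'n \<Rightarrow> real ^ 'n ^ 'n) \<Rightarrow> real ^ 'n \<Rightarrow> real ^ 'n ^ 'n::finite"
  where "lie_deriv_metric \<xi> g p = (\<chi> i j.
    (\<Sum>k\<in>UNIV. \<xi> p $ k * pderiv_at k (\<lambda>q. g q $ i $ j) p
       + g p $ k $ j * pderiv_at i (\<lambda>q. \<xi> q $ k) p
       + g p $ i $ k * pderiv_at j (\<lambda>q. \<xi> q $ k) p))"

definition ricci_soliton_field ::
    "(real ^ 'n \<Rightarrow> real ^ 'n ^ 'n) \<Rightarrow> (real ^ 'n \<Rightarrow> real ^ 'n) \<Rightarrow> bool"
  where "ricci_soliton_field g \<xi> \<longleftrightarrow> smooth_field \<xi> \<and>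
    (\<exists>c::real. \<forall>p. ricci g p + (1/2) *\<^sub>R lie_deriv_metric \<xi> g p = c *\<^sub>R g p)"


section \<open>Integral curves\<close>

definition integral_curve ::
    "('a::real_normed_vector \<Rightarrow> 'a) \<Rightarrow> (real \<Rightarrow> 'a) \<Rightarrow> real set \<Rightarrow> bool"
  where "integral_curve \<xi> \<gamma> I \<longleftrightarrow> open I \<and> is_interval I \<and> I \<noteq> {} \<and>
    (\<forall>s\<in>I. (\<gamma> has_vector_derivative \<xi> (\<gamma> s)) (at s))"

definition maximal_integral_curve ::
    "('a::real_normed_vector \<Rightarrow> 'a) \<Rightarrow> (real \<Rightarrow> 'a) \<Rightarrow> real set \<Rightarrow> bool"
  where "maximal_integral_curve \<xi> \<gamma> I \<longleftrightarrow> integral_curve \<xi> \<gamma> I \<and>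
    (\<forall>\<delta> J. integral_curve \<xi> \<delta> J \<and> I \<subseteq> J \<and> (\<forall>s\<in>I. \<delta> s = \<gamma> s) \<longrightarrow> J = I)"

definition complete_field :: "('a::real_normed_vector \<Rightarrow> 'a) \<Rightarrow> bool"
  where "complete_field \<xi> \<longleftrightarrow> (\<forall>p. \<exists>\<gamma>. integral_curve \<xi> \<gamma> UNIV \<and> \<gamma> 0 = p)"


section \<open>The space \<open>Sol\<^sup>3\<close> with parameters \<open>m\<close> and \<open>n\<close>\<close>

text \<open>The coordinates \<open>(x, y, t)\<close> of \<open>p\<close> are \<open>p $ 1\<close>, \<open>p $ 2\<close>, \<open>p $ 3\<close>.\<close>

definition sol_mult :: "real \<Rightarrow> real \<Rightarrow> real ^ 3 \<Rightarrow> real ^ 3 \<Rightarrow> real ^ 3"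
  where "sol_mult m n p q = vector
    [p $ 1 + exp (m * p $ 3) * q $ 1, p $ 2 + exp (- n * p $ 3) * q $ 2, p $ 3 + q $ 3]"

definition sol_metric :: "real \<Rightarrow> real \<Rightarrow> real ^ 3 \<Rightarrow> real ^ 3 ^ 3"
  where "sol_metric m n p = vector
    [vector [exp (- 2 * m * p $ 3), 0, 0],
     vector [0, exp (2 * n * p $ 3), 0],
     vector [0, 0, 1]]"

text \<open>The metric is invariant under left translations of the group.\<close>

lemma sol_mult_has_derivative:
  "(sol_mult m n a has_derivative
     (\<lambda>v. vector [exp (m * a $ 3) * v $ 1, exp (- n * a $ 3) * v $ 2, v $ 3])) (at p)"
proof -
  have nth: "((\<lambda>q. q $ i) has_derivative (\<lambda>v. v $ i)) (at p)" for i :: 3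
    by (rule bounded_linear_imp_has_derivative[OF bounded_linear_vec_nth])
  have "((\<lambda>q. sol_mult m n a q $ i) has_derivative
     (\<lambda>v. vector [exp (m * a $ 3) * v $ 1, exp (- n * a $ 3) * v $ 2, v $ 3] $ i)) (at p)"
    for i :: 3
    using exhaust_3[of i]
      nth[THEN has_derivative_mult_right, THEN has_derivative_add[OF has_derivative_const]]
      nth[THEN has_derivative_add[OF has_derivative_const]]
    by (auto simp: sol_mult_def)
  then show ?thesis
    by (subst has_derivative_componentwise_within) (auto simp: Basis_vec_def inner_axis)
qed

lemma sol_metric_left_invariant:
  assumes "(sol_mult m n a has_derivative D) (at p)"
  shows "D v \<bullet> (sol_metric m n (sol_mult m n a p) *v D w) = v \<bullet> (sol_metric m n p *v w)"
proof -
  have D: "D = (\<lambda>v. vector [exp (m * a $ 3) * v $ 1, exp (- n * a $ 3) * v $ 2, v $ 3])"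
    using assms sol_mult_has_derivative by (rule has_derivative_unique)
  have *: "exp u * (exp u * exp v) = exp (u + u + v)" for u v :: real
    by (simp only: exp_add mult.assoc)
  have 1: "exp (m * a $ 3) * (exp (m * a $ 3) * exp (- 2 * m * (a $ 3 + p $ 3)))
           = exp (- 2 * m * p $ 3)"
    and 2: "exp (- n * a $ 3) * (exp (- n * a $ 3) * exp (2 * n * (a $ 3 + p $ 3)))
           = exp (2 * n * p $ 3)"
    unfolding * by (simp_all add: algebra_simps)
  have "D v \<bullet> (sol_metric m n (sol_mult m n a p) *v D w) =
      (exp (m * a $ 3) * (exp (m * a $ 3) * exp (- 2 * m * (a $ 3 + p $ 3)))) * (v $ 1 * w $ 1)
    + (exp (- n * a $ 3) * (exp (- n * a $ 3) * exp (2 * n * (a $ 3 + p $ 3)))) * (v $ 2 * w $ 2)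
    + v $ 3 * w $ 3"
    unfolding D sol_metric_def sol_mult_def
    by (simp add: inner_vec_def matrix_vector_mult_def sum_3)
  also have "\<dots> = v \<bullet> (sol_metric m n p *v w)"
    unfolding 1 2 by (simp add: sol_metric_def inner_vec_def matrix_vector_mult_def sum_3)
  finally show ?thesis .
qed

end

(* In the diagonal metric both the Ricci tensor and the Lie derivative are diagonal, and the soliton
   equation holds with constant - (m^2 + n^2). The flow of \<xi> decouples into two scalar affine
   equations and one of constant velocity; an integrating factor solves each on an arbitrary
   open interval. The resulting formulas make sense on the whole line, so every integral curve
   extends to the whole line, and the constants can be chosen to start at any point. *)

theory Submission
  imports Defs
begin

section \<open>Partial derivatives\<close>

lemma pderiv_at_eq:
  assumes "(f has_derivative f') (at p)"
  shows "pderiv_at i f p = f' (axis i 1)"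
  using frechet_derivative_at[OF assms] by (simp add: pderiv_at_def)

text \<open>Each metric entry, Christoffel symbol and component of the soliton field depends on at
  most one coordinate, so with the constant case below this chain rule yields every partial
  derivative in the curvature computation.\<close>

lemma pderiv_at_coordinate_function:
  fixes F :: "real \<Rightarrow> real"
  assumes "(F has_real_derivative D) (at (p $ j))"
  shows "pderiv_at i (\<lambda>q. F (q $ j)) p = (if i = j then D else 0)"
proof -
  have "((\<lambda>q. q $ j) has_derivative (\<lambda>v. v $ j)) (at p)"
    by (rule bounded_linear_imp_has_derivative[OF bounded_linear_vec_nth])
  with assms have "((\<lambda>q. F (q $ j)) has_derivative (\<lambda>v. v $ j *\<^sub>R D)) (at p)"
    using has_derivative_compose[of "\<lambda>q. q $ j" "\<lambda>v. v $ j" p UNIV F "(*) D"]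
    by (simp add: has_field_derivative_def mult.commute)
  from pderiv_at_eq[OF this] show ?thesis
    by (simp add: axis_def)
qed

lemma pderiv_at_const [simp]: "pderiv_at i (\<lambda>q. c) p = 0"
  by (rule pderiv_at_eq) (rule has_derivative_const)

text \<open>Affine maps are closed under \<open>pderiv_at\<close>: a partial derivative of one is
  constant, that is, affine with linear part zero. Induction on the list of indices therefore keeps
  every iterated derivative affine, hence differentiable.\<close>

lemma smooth_field_affine:
  assumes "bounded_linear L"
  shows "smooth_field (\<lambda>p. L p + c)"
proof -
  have "\<exists>M d. bounded_linear M \<and> foldr pderiv_at is (\<lambda>p. L p + c) = (\<lambda>p. M p + d)" for "is"
  proof (induction "is")
    case Nil
    then show ?case using assms by auto
  next
    case (Cons i "is")
    then obtain M d where M: "bounded_linear M"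
      and eq: "foldr pderiv_at is (\<lambda>p. L p + c) = (\<lambda>p. M p + d)" by blast
    have "pderiv_at i (\<lambda>p. M p + d) = (\<lambda>p. M (axis i 1))"
    proof
      fix p
      show "pderiv_at i (\<lambda>p. M p + d) p = M (axis i 1)"
        by (rule pderiv_at_eq)
          (auto intro!: derivative_eq_intros bounded_linear_imp_has_derivative M)
    qed
    then have "foldr pderiv_at (i # is) (\<lambda>p. L p + c) = (\<lambda>p. 0 + M (axis i 1))"
      by (simp add: eq)
    then show ?case using bounded_linear_zero by blast
  qed
  moreover have "(\<lambda>p. M p + d) differentiable_on UNIV" if "bounded_linear M"
    for M :: "real ^ 'n \<Rightarrow> 'b" and d
    by (intro differentiable_on_add differentiable_on_const
        bounded_linear_imp_differentiable_on that)
  ultimately show ?thesis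
    unfolding smooth_field_def by metis
qed


section \<open>Curvature of \<open>Sol\<^sup>3\<close>\<close>

lemma sol_metric_nth [simp]:
  "sol_metric m n q $ i $ j =
    (if i \<noteq> j then 0 else if i = 1 then exp (- 2 * m * q $ 3)
     else if i = 2 then exp (2 * n * q $ 3) else 1)"
  using exhaust_3[of i] exhaust_3[of j] by (auto simp: sol_metric_def)

text \<open>\<open>matrix_inv\<close> is a Hilbert choice; uniqueness of two-sided inverses pins it
  down.\<close>

lemma matrix_inv_unique:
  fixes A :: "'a::semiring_1 ^ 'n ^ 'm"
  assumes "A ** B = mat 1" "B ** A = mat 1"
  shows "matrix_inv A = B"
  unfolding matrix_inv_def
proof (rule some_equality)
  show "C = B" if "A ** C = mat 1 \<and> C ** A = mat 1" for C
    using assms that by (metis matrix_mul_assoc matrix_mul_lid matrix_mul_rid)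
qed (use assms in simp)

text \<open>Negating \<open>m\<close> and \<open>n\<close> inverts the diagonal exponentials, so the
  inverse stays in the same family and \<open>sol_metric_nth\<close> also evaluates its
  entries.\<close>

lemma matrix_inv_sol_metric: "matrix_inv (sol_metric m n p) = sol_metric (- m) (- n) p"
proof (rule matrix_inv_unique)
  show "sol_metric m n p ** sol_metric (- m) (- n) p = mat 1"
    "sol_metric (- m) (- n) p ** sol_metric m n p = mat 1"
    by (simp add: vec_eq_iff forall_3 matrix_matrix_mult_def sum_3 mat_def flip: exp_add)+
qed

lemma pderiv_at_sol_metric:
  "pderiv_at k (\<lambda>q. sol_metric m n q $ i $ j) p =
    (if k \<noteq> 3 \<or> i \<noteq> j then 0 else if i = 1 then - 2 * m * exp (- 2 * m * p $ 3)
     else if i = 2 then 2 * n * exp (2 * n * p $ 3) else 0)"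
proof -
  have "((\<lambda>t. exp (a * t)) has_real_derivative a * exp (a * p $ 3)) (at (p $ 3))" for a
    by (auto intro!: derivative_eq_intros)
  from pderiv_at_coordinate_function[OF this]
  have "pderiv_at k (\<lambda>q. exp (a * q $ 3)) p = (if k = 3 then a * exp (a * p $ 3) else 0)" for a
    by simp
  from this[of "- 2 * m"] this[of "2 * n"] show ?thesis
    using exhaust_3[of i] exhaust_3[of j]
    by (elim disjE; simp)
qed

text \<open>Only t-derivatives of the two exponential diagonal entries survive. The form as an
  equation between functions allows rewriting under \<open>pderiv_at\<close>.\<close>

lemma christoffel_sol_metric:
  "christoffel (sol_metric m n) k i j =
    (\<lambda>p. if k = 1 \<and> (i = 1 \<and> j = 3 \<or> i = 3 \<and> j = 1) then - m
         else if k = 2 \<and> (i = 2 \<and> j = 3 \<or> i = 3 \<and> j = 2) then n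
         else if k = 3 \<and> i = 1 \<and> j = 1 then m * exp (- 2 * m * p $ 3)
         else if k = 3 \<and> i = 2 \<and> j = 2 then - n * exp (2 * n * p $ 3)
         else 0)"
proof -
  \<comment> \<open>An inverse entry times the derivative of the matching entry: the exponentials
    cancel, which leaves the constant symbols \<open>- m\<close> and \<open>n\<close>.\<close>
  have "exp (2 * m * u) * exp (- (2 * m * u)) = 1" "exp (- (2 * n * u)) * exp (2 * n * u) = 1" for u
    by (simp flip: exp_add)+
  then show ?thesis
    using exhaust_3[of k] exhaust_3[of i] exhaust_3[of j]
    unfolding christoffel_def matrix_inv_sol_metric pderiv_at_sol_metric
    by (elim disjE; auto simp: sum_3 fun_eq_iff)
qed

lemma pderiv_at_christoffel_sol_metric:
  "pderiv_at l (christoffel (sol_metric m n) k i j) p =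
    (if l = 3 \<and> k = 3 \<and> i = 1 \<and> j = 1 then - 2 * m\<^sup>2 * exp (- 2 * m * p $ 3)
     else if l = 3 \<and> k = 3 \<and> i = 2 \<and> j = 2 then - 2 * n\<^sup>2 * exp (2 * n * p $ 3)
     else 0)"
proof -
  have "((\<lambda>t. b * exp (a * t)) has_real_derivative a * b * exp (a * p $ 3)) (at (p $ 3))" for a b
    by (auto intro!: derivative_eq_intros)
  from pderiv_at_coordinate_function[OF this]
  have "pderiv_at l (\<lambda>q. b * exp (a * q $ 3)) p = (if l = 3 then a * b * exp (a * p $ 3) else 0)"
    for a b
    by simp
  from this[of m "- 2 * m"] this[of "- n" "2 * n"] show ?thesis
    using exhaust_3[of k] exhaust_3[of i] exhaust_3[of j]
    unfolding christoffel_sol_metric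
    by (elim disjE; simp add: power2_eq_square)
qed

text \<open>The trace of the symbols in direction t is n - m. In the first two diagonal entries the
  derivative term cancels against the quadratic term, leaving this trace times the symbol with upper
  index 3; the last entry is minus the sum of the squares of the constant symbols.\<close>

lemma ricci_sol_metric:
  "ricci (sol_metric m n) p = vector
    [vector [m * (n - m) * exp (- 2 * m * p $ 3), 0, 0],
     vector [0, n * (m - n) * exp (2 * n * p $ 3), 0],
     vector [0, 0, - (m\<^sup>2 + n\<^sup>2)]]"
  \<comment> \<open>Derivatives are rewritten first, while \<open>christoffel\<close> is still
    folded and the rule matches.\<close>
  unfolding ricci_def pderiv_at_christoffel_sol_metric
  unfolding christoffel_sol_metric
  by (simp add: vec_eq_iff forall_3 sum_3) (simp add: power2_eq_square algebra_simps)

lemma ricci_soliton_field_sol_metric: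
  fixes m n c1 c2 c3 :: real
  defines "\<xi> \<equiv> (\<lambda>p :: real ^ 3. vector
          [(m * c1 - m * n - n\<^sup>2) * p $ 1 + c2,
           - ((n * c1 + m * n + m\<^sup>2) * p $ 2 + c3),
           c1] :: real ^ 3)"
  shows "ricci_soliton_field (sol_metric m n) \<xi>"
  unfolding ricci_soliton_field_def
proof (intro conjI exI allI)
  define A B where "A = m * c1 - m * n - n\<^sup>2" and "B = n * c1 + m * n + m\<^sup>2"
  define L :: "real ^ 3 \<Rightarrow> real ^ 3" where "L = (\<lambda>p. vector [A * p $ 1, - (B * p $ 2), 0])"
  have "linear L"
    by (rule linearI; simp add: L_def vec_eq_iff forall_3 algebra_simps)
  then have "smooth_field (\<lambda>p. L p + vector [c2, - c3, c1])"
    by (intro smooth_field_affine) (simp add: linear_conv_bounded_linear)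
  moreover have "\<xi> = (\<lambda>p. L p + vector [c2, - c3, c1])"
    by (simp add: fun_eq_iff L_def \<xi>_def A_def B_def vec_eq_iff forall_3)
  ultimately show "smooth_field \<xi>" by simp
next
  fix p
  have "pderiv_at k (\<lambda>q. (m * c1 - m * n - n\<^sup>2) * q $ 1 + c2) p =
      (if k = 1 then m * c1 - m * n - n\<^sup>2 else 0)"
    "pderiv_at k (\<lambda>q. - ((n * c1 + m * n + m\<^sup>2) * q $ 2 + c3)) p =
      (if k = 2 then - (n * c1 + m * n + m\<^sup>2) else 0)" for k :: 3
    by (rule pderiv_at_coordinate_function; auto intro!: derivative_eq_intros)+
  then have d: "pderiv_at k (\<lambda>q. \<xi> q $ 1) p = (if k = 1 then m * c1 - m * n - n\<^sup>2 else 0)"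
    "pderiv_at k (\<lambda>q. \<xi> q $ 2) p = (if k = 2 then - (n * c1 + m * n + m\<^sup>2) else 0)"
    "pderiv_at k (\<lambda>q. \<xi> q $ 3) p = 0" for k
    unfolding \<xi>_def vector_3 by auto
  \<comment> \<open>The \<open>c1\<close> terms cancel: drift along t contributes -2 m c1 and 2 n c1
    to the factors of the exponentials, and the linear parts in x and y contribute the opposite
    amounts.\<close>
  have "lie_deriv_metric \<xi> (sol_metric m n) p = vector
    [vector [- 2 * n * (m + n) * exp (- 2 * m * p $ 3), 0, 0],
     vector [0, - 2 * m * (m + n) * exp (2 * n * p $ 3), 0],
     vector [0, 0, 0]]"
    unfolding lie_deriv_metric_def pderiv_at_sol_metric
    by (simp add: vec_eq_iff forall_3 sum_3 d) (simp add: \<xi>_def power2_eq_square algebra_simps)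
  \<comment> \<open>The Lie derivative has no dt^2 part, so that entry of the Ricci tensor dictates
    the soliton constant.\<close>
  then show "ricci (sol_metric m n) p + (1/2) *\<^sub>R lie_deriv_metric \<xi> (sol_metric m n) p
      = (- (m\<^sup>2 + n\<^sup>2)) *\<^sub>R sol_metric m n p"
    by (simp add: ricci_sol_metric vec_eq_iff forall_3 power2_eq_square algebra_simps)
qed


section \<open>Integral curves\<close>

lemma has_vector_derivative_vec3_iff:
  fixes f :: "real \<Rightarrow> real ^ 3"
  shows "(f has_vector_derivative D) (at s within S) \<longleftrightarrow>
    ((\<lambda>s. f s $ 1) has_vector_derivative D $ 1) (at s within S) \<and>
    ((\<lambda>s. f s $ 2) has_vector_derivative D $ 2) (at s within S) \<and>
    ((\<lambda>s. f s $ 3) has_vector_derivative D $ 3) (at s within S)"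
  unfolding has_vector_derivative_def
  by (subst has_derivative_componentwise_within)
    (auto simp: Basis_vec_def inner_axis UNIV_3)

text \<open>With the integrating factor \<open>exp (- a * s)\<close>, the function
  \<open>(f s + b / a) * exp (- a * s)\<close> has derivative zero, hence is constant on the
  interval; this constant is \<open>k\<close>.\<close>

lemma affine_ode_solution:
  fixes f :: "real \<Rightarrow> real"
  assumes "open I" "is_interval I" "a \<noteq> 0"
  shows "(\<forall>s\<in>I. (f has_vector_derivative a * f s + b) (at s)) \<longleftrightarrow>
    (\<exists>k. \<forall>s\<in>I. f s = k * exp (a * s) - b / a)"
proof
  assume f: "\<forall>s\<in>I. (f has_vector_derivative a * f s + b) (at s)"
  have "((\<lambda>s. (f s + b / a) * exp (- a * s)) has_vector_derivative 0) (at s within I)"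
    if "s \<in> I" for s
  proof -
    have "(f has_real_derivative a * f s + b) (at s)"
      using f that by (simp add: has_real_derivative_iff_has_vector_derivative)
    then have "((\<lambda>s. (f s + b / a) * exp (- a * s)) has_real_derivative 0) (at s)"
      using \<open>a \<noteq> 0\<close> by (auto intro!: derivative_eq_intros simp: field_simps)
    then show ?thesis
      by (simp add: has_real_derivative_iff_has_vector_derivative has_vector_derivative_at_within)
  qed
  then obtain k where k: "(f s + b / a) * exp (- a * s) = k" if "s \<in> I" for s
    using has_vector_derivative_zero_constant[OF is_interval_convex[OF assms(2)]] by blast
  have "f s = k * exp (a * s) - b / a" if "s \<in> I" for s
    using k[OF that] by (auto simp: exp_minus field_simps)
  then show "\<exists>k. \<forall>s\<in>I. f s = k * exp (a * s) - b / a" by blast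
next
  assume "\<exists>k. \<forall>s\<in>I. f s = k * exp (a * s) - b / a"
  then obtain k where k: "\<And>s. s \<in> I \<Longrightarrow> f s = k * exp (a * s) - b / a" by blast
  show "\<forall>s\<in>I. (f has_vector_derivative a * f s + b) (at s)"
  proof
    fix s assume s: "s \<in> I"
    have "((\<lambda>s. k * exp (a * s) - b / a) has_real_derivative a * f s + b) (at s)"
      using \<open>a \<noteq> 0\<close> by (auto intro!: derivative_eq_intros simp: k[OF s] field_simps)
    then show "(f has_vector_derivative a * f s + b) (at s)"
      unfolding has_real_derivative_iff_has_vector_derivative
      \<comment> \<open>The formula for \<open>f\<close> is known only on \<open>I\<close>; openness
        makes it hold near \<open>s\<close>, which suffices for the derivative.\<close>
      by (rule has_vector_derivative_transform_within_open[OF _ \<open>open I\<close> s]) (simp add: k)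
  qed
qed

text \<open>The equation of rate zero, which \<open>affine_ode_solution\<close> excludes: here
  \<open>f s - c * s\<close> is the conserved quantity.\<close>

lemma constant_velocity_solution:
  fixes f :: "real \<Rightarrow> real"
  assumes "open I" "is_interval I"
  shows "(\<forall>s\<in>I. (f has_vector_derivative c) (at s)) \<longleftrightarrow> (\<exists>k. \<forall>s\<in>I. f s = c * s + k)"
proof
  assume f: "\<forall>s\<in>I. (f has_vector_derivative c) (at s)"
  have "((\<lambda>s. f s - c * s) has_vector_derivative 0) (at s within I)" if "s \<in> I" for s
  proof -
    have "(f has_vector_derivative c) (at s within I)"
      using f that has_vector_derivative_at_within by blast
    then show ?thesis
      by (auto intro!: derivative_eq_intros)
  qed
  then obtain k where "f s - c * s = k" if "s \<in> I" for s
    using has_vector_derivative_zero_constant[OF is_interval_convex[OF assms(2)]] by blast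
  then show "\<exists>k. \<forall>s\<in>I. f s = c * s + k"
    by (metis add.commute diff_add_cancel)
next
  assume "\<exists>k. \<forall>s\<in>I. f s = c * s + k"
  then obtain k where k: "\<And>s. s \<in> I \<Longrightarrow> f s = c * s + k" by blast
  show "\<forall>s\<in>I. (f has_vector_derivative c) (at s)"
  proof
    fix s assume s: "s \<in> I"
    have "((\<lambda>s. c * s + k) has_vector_derivative c) (at s)"
      by (auto intro!: derivative_eq_intros)
    then show "(f has_vector_derivative c) (at s)"
      by (rule has_vector_derivative_transform_within_open[OF _ \<open>open I\<close> s]) (simp add: k)
  qed
qed

text \<open>Each component of the field involves only its own coordinate, so the three scalar
  equations are solved separately and their constants are independent.\<close>

lemma integral_curve_affine_diagonal_iff:
  fixes A B c1 c2 c3 :: real and \<gamma> :: "real \<Rightarrow> real ^ 3"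
  assumes "open I" "is_interval I" "I \<noteq> {}" "A \<noteq> 0" "B \<noteq> 0"
  shows "integral_curve (\<lambda>p. vector [A * p $ 1 + c2, - (B * p $ 2 + c3), c1]) \<gamma> I \<longleftrightarrow>
    (\<exists>a1 a2 t0. \<forall>s\<in>I. \<gamma> s = vector
       [a1 * exp (A * s) - c2 / A, a2 * exp (- B * s) - c3 / B, c1 * s + t0])"
proof -
  \<comment> \<open>This brings the y-equation to the form of \<open>affine_ode_solution\<close>
    with rate \<open>- B\<close> and offset \<open>- c3\<close>; the two signs cancel in the
    quotient and give \<open>c3 / B\<close>.\<close>
  have neg: "- (B * y + c3) = - B * y + - c3" for y by simp
  show ?thesis
    using assms affine_ode_solution[of I A "\<lambda>s. \<gamma> s $ 1" c2]
      affine_ode_solution[of I "- B" "\<lambda>s. \<gamma> s $ 2" "- c3"]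
      constant_velocity_solution[of I "\<lambda>s. \<gamma> s $ 3" c1]
    unfolding integral_curve_def has_vector_derivative_vec3_iff neg
    by (simp add: vec_eq_iff forall_3 ball_conj_distrib)
qed

theorem theorem7:
  fixes m n c1 c2 c3 :: real and \<xi> :: "real ^ 3 \<Rightarrow> real ^ 3"
  assumes "m > 0" and "n > 0"
    and "m * c1 - m * n - n\<^sup>2 \<noteq> 0"
    and "n * c1 + m * n + m\<^sup>2 \<noteq> 0"
    and "\<xi> = (\<lambda>p. vector
          [(m * c1 - m * n - n\<^sup>2) * p $ 1 + c2,
           - ((n * c1 + m * n + m\<^sup>2) * p $ 2 + c3),
           c1])"
  shows "ricci_soliton_field (sol_metric m n) \<xi> \<and>
    (\<forall>\<gamma> I. open I \<and> is_interval I \<and> I \<noteq> {} \<longrightarrow>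
       (integral_curve \<xi> \<gamma> I \<longleftrightarrow>
        (\<exists>a1 a2 t0 :: real. \<forall>s\<in>I. \<gamma> s = vector
           [a1 * exp ((m * c1 - m * n - n\<^sup>2) * s) - c2 / (m * c1 - m * n - n\<^sup>2),
            a2 * exp (- (n * c1 + m * n + m\<^sup>2) * s) - c3 / (n * c1 + m * n + m\<^sup>2),
            c1 * s + t0]))) \<and>
    (\<forall>\<gamma> I. maximal_integral_curve \<xi> \<gamma> I \<longrightarrow> I = UNIV) \<and>
    complete_field \<xi>"
proof -
  define A B where "A = m * c1 - m * n - n\<^sup>2" and "B = n * c1 + m * n + m\<^sup>2"
  define c where "c = (\<lambda>a1 a2 t0 s. vector
    [a1 * exp (A * s) - c2 / A, a2 * exp (- B * s) - c3 / B, c1 * s + t0] :: real ^ 3)"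
  have nz: "A \<noteq> 0" "B \<noteq> 0" and \<xi>: "\<xi> = (\<lambda>p. vector [A * p $ 1 + c2, - (B * p $ 2 + c3), c1])"
    using assms by (simp_all add: A_def B_def)
  have curve_iff: "integral_curve \<xi> \<gamma> I \<longleftrightarrow> (\<exists>a1 a2 t0. \<forall>s\<in>I. \<gamma> s = c a1 a2 t0 s)"
    if "open I" "is_interval I" "I \<noteq> {}" for \<gamma> I
    using integral_curve_affine_diagonal_iff[OF that nz] unfolding \<xi> c_def .
  have global: "integral_curve \<xi> (c a1 a2 t0) UNIV" for a1 a2 t0
    using curve_iff[of UNIV "c a1 a2 t0"] by auto
  have "I = UNIV" if max: "maximal_integral_curve \<xi> \<gamma> I" for \<gamma> I
  proof -
    from max have "integral_curve \<xi> \<gamma> I"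
      by (simp add: maximal_integral_curve_def)
    then obtain a1 a2 t0 where "\<forall>s\<in>I. \<gamma> s = c a1 a2 t0 s"
      using curve_iff[of I \<gamma>] by (auto simp: integral_curve_def)
    \<comment> \<open>The same constants define a curve on the whole line that agrees with
      \<open>\<gamma>\<close> on \<open>I\<close>; maximality then forces \<open>I\<close> to be
      everything.\<close>
    with max global[of a1 a2 t0] show ?thesis
      unfolding maximal_integral_curve_def by (metis subset_UNIV)
  qed
  moreover have "complete_field \<xi>"
    unfolding complete_field_def
  proof
    fix p
    \<comment> \<open>At time 0 the exponentials equal 1, so adding \<open>c2 / A\<close> and
      \<open>c3 / B\<close> compensates the equilibrium shifts in the solution formula.\<close>
    have "c (p $ 1 + c2 / A) (p $ 2 + c3 / B) (p $ 3) 0 = p"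
      by (simp add: c_def vec_eq_iff forall_3)
    with global show "\<exists>\<gamma>. integral_curve \<xi> \<gamma> UNIV \<and> \<gamma> 0 = p" by blast
  qed
  moreover have "ricci_soliton_field (sol_metric m n) \<xi>"
    unfolding assms(5) by (rule ricci_soliton_field_sol_metric)
  ultimately show ?thesis
    using curve_iff unfolding c_def A_def B_def by blast
qed

end
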